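(* Every 3-connected locally maximal 1-planar graph has a 3-connected planar spanning subgraph.
   Context: All graphs are finite and simple. A 1-planar drawing of a graph is a drawing in the plane in which each edge is crossed at most once by another edge; two crossing edges cross exactly once and have four distinct end vertices. A crossing is full if the four end vertices of its two edges induce a complete graph $K_4$. A graph is locally maximal 1-planar if it has a 1-planar drawing in which every crossing is full. *)

theory Defs
  imports "HOL-Analysis.Analysis"
begin

text \<open>Graphs are given by a vertex set and a set of edges, each edge being a two-element
  set of vertices.\<close>

definition simple_graph :: "'a set \<Rightarrow> 'a set set \<Rightarrow> bool" where
  "simple_graph V E \<longleftrightarrow> finite V \<and> (\<forall>e\<in>E. e \<subseteq> V \<and> card e = 2)"

definition connected_graph :: "'a set \<Rightarrow> 'a set set \<Rightarrow> bool" where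
  "connected_graph V E \<longleftrightarrow> V \<noteq> {} \<and> (\<forall>u\<in>V. \<forall>v\<in>V. (u, v) \<in> {(x, y). {x, y} \<in> E}\<^sup>*)"

definition k_connected :: "nat \<Rightarrow> 'a set \<Rightarrow> 'a set set \<Rightarrow> bool" where
  "k_connected k V E \<longleftrightarrow> k < card V \<and>
     (\<forall>X. X \<subseteq> V \<and> card X < k \<longrightarrow> connected_graph (V - X) {e \<in> E. e \<inter> X = {}})"

definition arc_interior :: "(real \<Rightarrow> complex) \<Rightarrow> complex set" where
  "arc_interior g = path_image g - {pathstart g, pathfinish g}"

text \<open>Two curves cross at \<open>x\<close> (as opposed to merely touching there) if near \<open>x\<close> they look,
  up to homeomorphism, like the two coordinate axes near the origin.\<close>

definition crosses_at :: "(real \<Rightarrow> complex) \<Rightarrow> (real \<Rightarrow> complex) \<Rightarrow> complex \<Rightarrow> bool" where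
  "crosses_at g h x \<longleftrightarrow>
     (\<exists>U \<phi> \<psi>. open U \<and> x \<in> U \<and> homeomorphism U (ball 0 1) \<phi> \<psi> \<and> \<phi> x = 0 \<and>
        \<phi> ` (U \<inter> path_image g) = {z \<in> ball 0 1. Im z = 0} \<and>
        \<phi> ` (U \<inter> path_image h) = {z \<in> ball 0 1. Re z = 0})"

text \<open>A drawing places the vertices at distinct points \<open>p v\<close> of the plane and draws each edge \<open>e\<close>
  as a simple arc \<open>c e\<close> between its end vertices (in either direction) that avoids all other
  vertices. Any point interior to two edges has to be a proper crossing, so that in a
  drawing ``having a common interior point'' and ``crossing'' are the same.\<close>

definition drawing ::
  "'a set \<Rightarrow> 'a set set \<Rightarrow> ('a \<Rightarrow> complex) \<Rightarrow> ('a set \<Rightarrow> real \<Rightarrow> complex) \<Rightarrow> bool" where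
  "drawing V E p c \<longleftrightarrow>
     inj_on p V \<and>
     (\<forall>e\<in>E. arc (c e) \<and> {pathstart (c e), pathfinish (c e)} = p ` e \<and>
             arc_interior (c e) \<inter> p ` V = {}) \<and>
     (\<forall>e\<in>E. \<forall>f\<in>E. e \<noteq> f \<longrightarrow>
        (\<forall>x \<in> arc_interior (c e) \<inter> arc_interior (c f). crosses_at (c e) (c f) x))"

definition edges_cross :: "('a set \<Rightarrow> real \<Rightarrow> complex) \<Rightarrow> 'a set \<Rightarrow> 'a set \<Rightarrow> bool" where
  "edges_cross c e f \<longleftrightarrow> e \<noteq> f \<and> arc_interior (c e) \<inter> arc_interior (c f) \<noteq> {}"

definition one_planar_drawing ::
  "'a set \<Rightarrow> 'a set set \<Rightarrow> ('a \<Rightarrow> complex) \<Rightarrow> ('a set \<Rightarrow> real \<Rightarrow> complex) \<Rightarrow> bool" where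
  "one_planar_drawing V E p c \<longleftrightarrow> drawing V E p c \<and>
     (\<forall>e\<in>E. \<forall>f\<in>E. edges_cross c e f \<longrightarrow>
        (\<exists>!x. x \<in> arc_interior (c e) \<inter> arc_interior (c f)) \<and>
        e \<inter> f = {} \<and>
        (\<forall>g\<in>E. edges_cross c e g \<longrightarrow> g = f))"

definition full_crossing :: "'a set set \<Rightarrow> 'a set \<Rightarrow> 'a set \<Rightarrow> bool" where
  "full_crossing E e f \<longleftrightarrow>
     card (e \<union> f) = 4 \<and> (\<forall>u \<in> e \<union> f. \<forall>v \<in> e \<union> f. u \<noteq> v \<longrightarrow> {u, v} \<in> E)"

definition locally_maximal_one_planar :: "'a set \<Rightarrow> 'a set set \<Rightarrow> bool" where
  "locally_maximal_one_planar V E \<longleftrightarrow>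
     (\<exists>p c. one_planar_drawing V E p c \<and>
        (\<forall>e\<in>E. \<forall>f\<in>E. edges_cross c e f \<longrightarrow> full_crossing E e f))"

definition planar :: "'a set \<Rightarrow> 'a set set \<Rightarrow> bool" where
  "planar V E \<longleftrightarrow>
     (\<exists>p c. drawing V E p c \<and> (\<forall>e\<in>E. \<forall>f\<in>E. \<not> edges_cross c e f))"

definition spanning_subgraph :: "'a set \<Rightarrow> 'a set set \<Rightarrow> 'a set \<Rightarrow> 'a set set \<Rightarrow> bool" where
  "spanning_subgraph W F V E \<longleftrightarrow> W = V \<and> F \<subseteq> E"

end

theory Submission
  imports Defs
begin

text \<open>If $ac$ and $bd$ cross, the sector at the crossing point between the half-edges towards
  $a$ and $b$ lies in one face, whose boundary contains both half-edges; hence the edge $ab$ can be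
  redrawn inside this face. In a drawing with the minimum number of crossing pairs the edges
  $ab$, $bc$, $cd$, $da$ are therefore uncrossed, so every crossing pair leaves a 4-cycle $abcd$
  behind when one or both of its edges are deleted. Deleting $ac$ can then only create the 2-cut
  $\{b, d\}$, and does so only if $ac$ is a bridge of $G - \{b, d\}$. If, in addition, $bd$ were a
  bridge of $G - \{a, c\}$, then the two bipartitions would isolate every further vertex behind a
  2-cut such as $\{a, b\}$ of $G$; so, unless $G$ has four vertices, from every crossing pair one
  edge can be deleted without destroying 3-connectedness.\<close>

section \<open>Faces of plane sets and the arcs on their boundary\<close>

text \<open>Edges are arbitrary simple arcs: near a vertex an arc may spiral, with other edges
  accumulating against it, so a new edge cannot simply run at a small distance beside two
  half-edges. The redrawing therefore argues with faces alone. Only the crossing point is tame by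
  definition; it supplies one face touching both half-edges. Janiszewski's theorem spreads this
  contact along each of them, and the end vertices are reached as limits of infinite chains of paths
  in shrinking discs. Edges are deleted from all crossing pairs at once. The deletions do not
  interfere: a cut of at most two vertices contains both ends of a partner edge only if it equals
  that edge, so for each cut at most one deleted edge needs a genuine detour, and every other one is
  bypassed through an end of its partner. Four vertices are exceptional because a 3-connected graph
  on them is $K_4$, which loses 3-connectedness with any edge; it is planar as a whole.\<close>

lemma connected_subset_if_closure:
  fixes C :: "'a::topological_space set"
  assumes "connected Z" "open C" "C \<inter> Z \<noteq> {}" "closure C \<inter> Z \<subseteq> C"
  shows "Z \<subseteq> C"
proof (rule ccontr)
  assume "\<not> Z \<subseteq> C"
  then have "Z \<inter> frontier C \<noteq> {}"
    using assms(1,3) by (intro connected_Int_frontier) auto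
  then show False
    using assms(2,4) by (auto simp: frontier_def interior_open)
qed

text \<open>Components are relatively closed, so new limit points of a face lie outside
  \<open>U\<close>, that is, on the obstacle.\<close>

lemma closure_component_subset:
  fixes U :: "'a::topological_space set"
  shows "closure (connected_component_set U s) \<inter> U \<subseteq> connected_component_set U s"
proof -
  have "closedin (top_of_set U) (connected_component_set U s)"
    by (simp add: closedin_connected_component)
  then obtain D where "closed D" and D: "connected_component_set U s = U \<inter> D"
    by (auto simp: closedin_closed)
  then have "closure (connected_component_set U s) \<subseteq> D"
    by (metis closure_minimal inf_le2)
  with D show ?thesis by blast
qed

text \<open>If the boundary of \<open>C\<close> stopped at a gap beyond \<open>t\<close>, then \<open>C\<close> would still be a face after
  removing the gap from the arc. The initial piece of the arc then dangles: by Janiszewski's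
  theorem it separates nothing, so \<open>C\<close> would reach the points of the gap.\<close>

lemma face_closure_along_arc_forward:
  fixes g :: "real \<Rightarrow> complex"
  assumes C: "open C" "C \<inter> (R \<union> path_image g) = {}" "closure C \<subseteq> C \<union> R \<union> path_image g"
    and R: "closed R" and g: "arc g" and ends: "R \<inter> path_image g \<subseteq> {g 0, g 1}"
    and t: "0 < t" "t < t'" "t' < 1" "g t \<in> closure C"
  shows "g t' \<in> closure C"
proof (rule ccontr)
  assume nin: "g t' \<notin> closure C"
  have cont: "continuous_on {0..1} g" and inj: "inj_on g {0..1}"
    using g by (auto simp: arc_def path_def)
  have "open (- closure C)" "g t' \<in> - closure C" using nin by auto
  moreover have "continuous_on {t'..1} g"
    using cont t by (auto intro: continuous_on_subset)
  ultimately obtain d where d: "d > 0" "\<And>u. \<lbrakk>u \<in> {t'..1}; dist u t' < d\<rbrakk> \<Longrightarrow> g u \<notin> closure C"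
    using t continuous_on_topological [of "{t'..1}" g]
    by (smt (verit, ccfv_threshold) ComplD atLeastAtMost_iff open_dist)
  obtain r where "0 < r" "r < d" "r < 1 - t'"
    using d(1) t(3) field_lbound_gt_zero[of d "1 - t'"] by auto
  moreover define t'' where "t'' = t' + r"
  ultimately have t'': "t' < t''" "t'' < t' + d" "t'' < 1" by auto
  have dd: "g u \<notin> closure C" if "u \<in> {t'..t''}" for u
    using that t'' by (intro d(2)) (auto simp: dist_real_def)
  define m where "m = (t' + t'')/2"
  have m: "t' < m" "m < t''" using t'' by (auto simp: m_def)
  define S where "S = g ` {0..t'}"
  define T where "T = R \<union> g ` {t''..1}"
  have ne: "g u \<noteq> g v" if "u \<in> {0..1}" "v \<in> {0..1}" "u \<noteq> v" for u v
    using that inj by (auto simp: inj_on_def)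
  have notR: "g u \<notin> R" if "0 < u" "u < 1" for u
  proof
    assume "g u \<in> R"
    then have "g u \<in> {g 0, g 1}" using ends that by (auto simp: path_image_def)
    then show False using ne[of u 0] ne[of u 1] that by auto
  qed
  have S_arc: "S = path_image (subpath 0 t' g)" "arc (subpath 0 t' g)"
    using t g by (auto simp: S_def path_image_subpath arc_subpath_arc)
  have "compact (g ` {t''..1})"
    using cont t'' t by (auto intro!: compact_continuous_image intro: continuous_on_subset)
  then have clT: "closed T" using R by (auto simp: T_def compact_imp_closed)
  have ST: "S \<inter> T \<subseteq> {g 0}"
  proof
    fix z assume z: "z \<in> S \<inter> T"
    then obtain u where u: "z = g u" "0 \<le> u" "u \<le> t'" by (auto simp: S_def)
    have "z \<notin> g ` {t''..1}" using u t t'' inj_on_image_mem_iff[OF inj, of u "{t''..1}"] by auto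
    then have "g u \<in> R" using z u by (auto simp: T_def)
    then have "u = 0" using notR[of u] u t by force
    then show "z \<in> {g 0}" using u by simp
  qed
  have gtT: "g u \<notin> T" if "0 < u" "u < t''" for u
  proof -
    have "g u \<notin> g ` {t''..1}"
      using inj_on_image_mem_iff[OF inj, of u "{t''..1}"] that t t'' by auto
    then show ?thesis using notR[of u] that t'' by (auto simp: T_def)
  qed
  obtain e where e: "e > 0" "ball (g t) e \<subseteq> - T"
    using gtT[of t] t t'' clT open_contains_ball[of "- T"] by (auto simp: open_Compl)
  obtain s where s: "s \<in> C" "s \<in> ball (g t) e"
    using t(4) e by (metis closure_approachable dist_commute mem_ball)
  have "connected_component (- T) s (g t)"
    using s e by (auto intro!: connected_componentI[of "ball (g t) e"])
  moreover have "connected_component (- T) (g t) (g m)"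
  proof (rule connected_componentI[of "g ` {t..m}"])
    show "connected (g ` {t..m})"
      using cont t t'' m by (auto intro!: connected_continuous_image intro: continuous_on_subset)
    show "g ` {t..m} \<subseteq> - T" using gtT t m by force
  qed (use t m in auto)
  ultimately have cT: "connected_component (- T) s (g m)"
    by (rule connected_component_trans)
  have "connected (- S)"
    using connected_arc_complement[OF S_arc(2)] S_arc(1) by simp
  moreover have "S \<subseteq> path_image g" unfolding S_def path_image_def using t by (intro image_mono) auto
  then have "s \<in> - S" using s C(2) by blast
  moreover have "g m \<in> - S" using inj_on_image_mem_iff[OF inj, of m "{0..t'}"] m t t'' by (auto simp: S_def)
  ultimately have cS: "connected_component (- S) s (g m)"
    by (auto intro: connected_componentI[of "- S"])
  \<comment> \<open>Janiszewski's theorem needs a connected intersection; \<open>S\<close> and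
    \<open>T\<close> share at most the start of the arc.\<close>
  have "connected (S \<inter> T)"
    using ST by (metis connected_empty connected_sing subset_singletonD)
  then have "connected_component (- (S \<union> T)) s (g m)"
    using S_arc clT cS cT by (intro Janiszewski) (auto simp: compact_arc_image)
  then obtain Z where Z: "connected Z" "Z \<subseteq> - (S \<union> T)" "s \<in> Z" "g m \<in> Z"
    by (auto simp: connected_component_def)
  \<comment> \<open>\<open>Z\<close> avoids \<open>S\<close> and \<open>T\<close>, so it can meet
    the arc only in the gap, which \<open>closure C\<close> misses. Hence \<open>Z\<close> cannot
    leave \<open>C\<close>, although it ends at the gap point \<open>g m\<close>.\<close>
  have "Z \<subseteq> C"
  proof (rule connected_subset_if_closure)
    show "closure C \<inter> Z \<subseteq> C"
    proof
      fix z assume z: "z \<in> closure C \<inter> Z"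
      have "z \<notin> path_image g"
      proof
        assume "z \<in> path_image g"
        then obtain u where u: "z = g u" "0 \<le> u" "u \<le> 1" by (auto simp: path_image_def)
        have "g u \<notin> S \<union> T" using z Z(2) u(1) by blast
        then have "\<not> u \<le> t'" "\<not> t'' \<le> u" using u by (auto simp: S_def T_def)
        then have "u \<in> {t'..t''}" by simp
        then show False using dd z u by auto
      qed
      then show "z \<in> C" using z C(3) Z(2) by (auto simp: T_def)
    qed
  qed (use Z C s in auto)
  then show False using Z(4) C(2) m t t'' by (auto simp: path_image_def)
qed

text \<open>Reversing the arc turns forward propagation into backward propagation, and continuity
  adds the two end points.\<close>

lemma face_closure_contains_arc:
  fixes g :: "real \<Rightarrow> complex"
  assumes C: "open C" "C \<inter> (R \<union> path_image g) = {}" "closure C \<subseteq> C \<union> R \<union> path_image g"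
    and R: "closed R" and g: "arc g" and ends: "R \<inter> path_image g \<subseteq> {g 0, g 1}"
    and t: "0 < t" "t < 1" "g t \<in> closure C"
  shows "path_image g \<subseteq> closure C"
proof -
  have "g u \<in> closure C" if u: "0 < u" "u < 1" for u
  proof (cases u t rule: linorder_cases)
    case less
    have "reversepath g (1 - u) \<in> closure C"
      using C R g ends t u less
      by (intro face_closure_along_arc_forward[of C R "reversepath g" "1 - t" "1 - u"])
        (auto simp: arc_reversepath, auto simp: reversepath_def)
    then show ?thesis by (simp add: reversepath_def)
  next
    case equal
    then show ?thesis using t by simp
  next
    case greater
    show ?thesis using face_closure_along_arc_forward[OF C R g ends t(1) greater u(2) t(3)] .
  qed
  then have "g ` {0<..<1} \<subseteq> closure C" by auto
  moreover have "continuous_on (closure {0<..<1}) g"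
    using g by (simp add: arc_def path_def)
  ultimately have "g ` closure {0<..<1} \<subseteq> closure C"
    by (intro image_closure_subset) auto
  then show ?thesis by (simp add: path_image_def)
qed

section \<open>Accessibility of the end point of an arc from a face\<close>

lemma infinite_path_join:
  fixes p :: "nat \<Rightarrow> real \<Rightarrow> 'a::real_normed_vector"
  assumes p: "\<And>n. path (p n)" "\<And>n. pathfinish (p n) = pathstart (p (Suc n))"
    and S: "\<And>n. path_image (p n) \<subseteq> S"
    and lim: "\<And>e. e > 0 \<Longrightarrow> \<exists>N. \<forall>n\<ge>N. path_image (p n) \<subseteq> ball a e"
  obtains q where "path q" "pathstart q = pathstart (p 0)" "pathfinish q = a" "path_image q \<subseteq> insert a S"
proof -
  define G where "G t = p (nat \<lfloor>t\<rfloor>) (frac t)" for t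
  \<comment> \<open>At \<open>t = real n + 1\<close> the floor already selects
    \<open>p (Suc n)\<close>; the matching ends give the same value, so the formula holds on closed
    intervals, which can be glued.\<close>
  have Gn: "G t = p n (t - real n)" if "real n \<le> t" "t \<le> real n + 1" for n t
  proof (cases "t = real n + 1")
    case True
    then have "\<lfloor>t\<rfloor> = int n + 1" by linarith
    then have "nat \<lfloor>t\<rfloor> = Suc n" "frac t = 0" using True by (linarith, simp add: frac_def)
    then have "G t = p (Suc n) 0" by (simp only: G_def)
    then show ?thesis using True p(2)[of n] by (simp add: pathstart_def pathfinish_def)
  next
    case False
    then have "\<lfloor>t\<rfloor> = int n" using that by linarith
    then show ?thesis by (simp add: G_def frac_def)
  qed
  have Gin: "G t \<in> path_image (p (nat \<lfloor>t\<rfloor>))" for t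
    using frac_ge_0[of t] frac_lt_1[of t] by (auto simp: G_def path_image_def less_imp_le)
  have contG: "continuous_on {0..real n} G" for n
  proof (induction n)
    case (Suc n)
    have "continuous_on {real n..real n + 1} (\<lambda>t. p n (t - real n))"
      by (rule continuous_on_compose2[of "{0..1}" "p n"])
        (use p(1)[of n] in \<open>auto simp: path_def intro!: continuous_intros\<close>)
    then have "continuous_on {real n..real n + 1} G"
      using Gn by (subst continuous_on_cong) auto
    with Suc have "continuous_on ({0..real n} \<union> {real n..real n + 1}) G"
      by (intro continuous_on_closed_Un) auto
    moreover have "{0..real n} \<union> {real n..real n + 1} = {0..real (Suc n)}" by auto
    ultimately show ?case by simp
  qed simp
  \<comment> \<open>\<open>t / (1 - t)\<close> stretches [0,1) to the half-line on which the pieces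
    are laid out one after the other.\<close>
  define q where "q t = (if t < 1 then G (t / (1 - t)) else a)" for t
  have "path q"
    unfolding path_def continuous_on_eq_continuous_within
  proof
    fix t :: real assume t: "t \<in> {0..1}"
    show "continuous (at t within {0..1}) q"
    proof (cases "t = 1")
      case False
      define c where "c = (1 + t) / 2"
      have c: "t < c" "c < 1" "0 < c" using False t by (auto simp: c_def)
      obtain n where n: "c / (1 - c) \<le> real n" using real_arch_simple by blast
      have sub: "u / (1 - u) \<in> {0..real n}" if "u \<in> {0..c}" for u
      proof -
        have "u / (1 - u) \<le> c / (1 - c)" using that c by (intro frac_le) auto
        then show ?thesis using that c n by auto
      qed
      have "continuous_on {0..c} (\<lambda>u. G (u / (1 - u)))"
        by (rule continuous_on_compose2[OF contG[of n]])
          (use sub c in \<open>auto intro!: continuous_intros\<close>)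
      then have "continuous_on {0..c} q"
        by (rule continuous_on_eq) (use c in \<open>auto simp: q_def\<close>)
      then have "continuous (at t within {0..c}) q"
        using t c by (auto simp: continuous_on_eq_continuous_within)
      moreover have "at t within {0..c} = at t within {0..1}"
        by (rule at_within_nhd[of _ "{..<c}"]) (use c in auto)
      ultimately show ?thesis by simp
    next
      case True
      have "\<exists>d>0. \<forall>u\<in>{0..1}. dist u t < d \<longrightarrow> dist (q u) (q t) < e" if e: "e > 0" for e
      proof -
        obtain N where N: "\<And>n. n \<ge> N \<Longrightarrow> path_image (p n) \<subseteq> ball a e" using lim[OF e] by auto
        \<comment> \<open>With \<open>1 - u\<close> below \<open>1 / (real N + 2)\<close> the
          stretched parameter is at least \<open>N\<close>, so only pieces inside the ball are
          visited.\<close>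
        have "dist (q u) (q t) < e" if u: "u \<in> {0..1}" "dist u t < 1 / (real N + 2)" for u
        proof (cases "u < 1")
          case True
          have d: "1 - u < 1 / (real N + 2)" "1 - u > 0"
            using u True \<open>t = 1\<close> by (auto simp: dist_real_def)
          have "real N * (1 - u) \<le> (real N + 2) * (1 - u) - (1 - u)" using d by (simp add: algebra_simps)
          moreover have "(real N + 2) * (1 - u) < 1" using d by (simp add: field_simps)
          ultimately have "real N * (1 - u) \<le> u" by linarith
          then have "real N \<le> u / (1 - u)" using d by (simp add: pos_le_divide_eq)
          then have "N \<le> nat \<lfloor>u / (1 - u)\<rfloor>" by linarith
          then have "G (u / (1 - u)) \<in> ball a e" using N Gin by blast
          then show ?thesis using True \<open>t = 1\<close> by (simp add: q_def dist_commute)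
        qed (use e \<open>t = 1\<close> in \<open>simp add: q_def\<close>)
        then show ?thesis by (intro exI[of _ "1 / (real N + 2)"]) auto
      qed
      then show ?thesis by (simp add: continuous_within_eps_delta)
    qed
  qed
  moreover have "pathstart q = pathstart (p 0)" "pathfinish q = a"
    by (simp_all add: pathstart_def pathfinish_def q_def G_def)
  moreover have "path_image q \<subseteq> insert a S"
    using subsetD[OF S Gin] by (auto simp: path_image_def q_def)
  ultimately show ?thesis using that by blast
qed

text \<open>The face of \<open>U - K\<close> through \<open>s\<close> touches a final piece of the arc \<open>g\<close> that stays inside \<open>U\<close>.
  This property can be passed on to ever smaller neighbourhoods of the end point \<open>g 1\<close>, which
  makes that point accessible although the arcs may be arbitrarily wild there.\<close>

definition abutting ::
  "complex set \<Rightarrow> (real \<Rightarrow> complex) \<Rightarrow> complex set \<Rightarrow> complex \<Rightarrow> bool" where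
  "abutting K g U s \<longleftrightarrow> s \<in> U - K \<and>
     (\<exists>t0\<in>{0<..<1}. g ` {t0..1} \<subseteq> U \<and>
        (\<exists>t\<in>{t0<..<1}. g t \<in> closure (connected_component_set (U - K) s)))"

text \<open>Since the face touches the whole final piece of \<open>g\<close>, it also comes close to
  a point of that piece inside \<open>U'\<close>. A point \<open>s'\<close> of the face chosen there
  lies in a component of \<open>U' - K\<close> that again touches the arc.\<close>

lemma abutting_shrink:
  assumes R: "closed R" and g: "arc g" and ends: "R \<inter> path_image g \<subseteq> {g 0, g 1}"
    and K: "K = R \<union> path_image g"
    and U: "open U" "open U'" "U' \<subseteq> U" "g 1 \<in> U'" and s: "abutting K g U s"
  obtains s' where "abutting K g U' s'" "s' \<in> connected_component_set (U - K) s"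
proof -
  define C where "C = connected_component_set (U - K) s"
  have cont: "continuous_on {0..1} g" and inj: "inj_on g {0..1}"
    using g by (auto simp: arc_def path_def)
  have ne: "g u \<noteq> g v" if "u \<in> {0..1}" "v \<in> {0..1}" "u \<noteq> v" for u v
    using that inj by (auto simp: inj_on_def)
  have clg: "closed (g ` {u..v})" if "0 \<le> u" "v \<le> 1" for u v
    using that cont
    by (intro compact_imp_closed compact_continuous_image) (auto intro: continuous_on_subset)
  have clK: "closed K" using K R g by (simp add: closed_Un closed_arc_image)
  have openC: "open C" using U clK by (simp add: C_def open_connected_component open_Diff)
  have Csub: "C \<subseteq> U - K" by (simp add: C_def connected_component_subset)
  have Ccl: "closure C \<inter> (U - K) \<subseteq> C" unfolding C_def by (rule closure_component_subset)
  obtain t0 t where t0: "0 < t0" "t0 < 1" "g ` {t0..1} \<subseteq> U" and t: "t0 < t" "t < 1" "g t \<in> closure C"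
    using s by (auto simp: abutting_def C_def)
  define h where "h = subpath t0 1 g"
  \<comment> \<open>Adding the complement of \<open>U\<close> to the obstacle makes the component
    \<open>C\<close> of \<open>U - K\<close> a face in the whole plane, so that
    \<open>face_closure_contains_arc\<close> applies to the final piece \<open>h\<close>.\<close>
  define R' where "R' = R \<union> g ` {0..t0} \<union> - U"
  have arch: "arc h" using g t0 by (simp add: h_def arc_subpath_arc)
  have imh: "path_image h = g ` {t0..1}" using t0 by (simp add: h_def path_image_subpath)
  have un: "R' \<union> path_image h = K \<union> - U"
  proof -
    have "{0..1} = {0..t0} \<union> {t0..1}" using t0 by auto
    then have "path_image g = g ` {0..t0} \<union> g ` {t0..1}" unfolding path_image_def by (metis image_Un)
    then show ?thesis unfolding imh R'_def K by blast
  qed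
  have h: "h u = g (t0 + (1 - t0) * u)" for u by (simp add: h_def subpath_def algebra_simps)
  have endsh: "R' \<inter> path_image h \<subseteq> {h 0, h 1}"
  proof
    fix z assume z: "z \<in> R' \<inter> path_image h"
    then obtain u where u: "z = g u" "t0 \<le> u" "u \<le> 1" by (auto simp: imh)
    then have "g u \<in> U" using t0(3) by auto
    then have "g u \<in> R \<or> g u \<in> g ` {0..t0}" using z u(1) by (auto simp: R'_def)
    then show "z \<in> {h 0, h 1}"
    proof
      assume "g u \<in> R"
      then have "g u \<in> {g 0, g 1}" using ends u t0 by (auto simp: path_image_def)
      then have "u = 1" using ne[of u 0] ne[of u 1] u t0 by auto
      then show ?thesis using u by (simp add: h)
    next
      assume "g u \<in> g ` {0..t0}"
      then obtain v where "g u = g v" "0 \<le> v" "v \<le> t0" by auto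
      then have "u = t0" using ne[of u v] u t0 by force
      then show ?thesis using u by (simp add: h)
    qed
  qed
  have hC: "path_image h \<subseteq> closure C"
  proof (rule face_closure_contains_arc[of C R' h "(t - t0) / (1 - t0)"])
    show "C \<inter> (R' \<union> path_image h) = {}" using Csub un by auto
    show "closure C \<subseteq> C \<union> R' \<union> path_image h" using Ccl un by auto
    show "closed R'" using R clg[of 0 t0] U t0 by (auto simp: R'_def)
    show "h ((t - t0) / (1 - t0)) \<in> closure C" using t t0 by (simp add: h)
  qed (use t t0 openC arch endsh in \<open>auto simp: divide_simps\<close>)
  obtain t1 where t1: "t0 < t1" "t1 < 1" "g ` {t1..1} \<subseteq> U'"
  proof -
    obtain d where d: "d > 0" "\<And>u. \<lbrakk>u \<in> {0..1}; dist u 1 < d\<rbrakk> \<Longrightarrow> g u \<in> U'"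
    proof -
      obtain e where e: "e > 0" "ball (g 1) e \<subseteq> U'" using U open_contains_ball by blast
      obtain d where "d > 0" "\<And>u. \<lbrakk>u \<in> {0..1}; dist u 1 < d\<rbrakk> \<Longrightarrow> dist (g u) (g 1) < e"
        using cont e(1) unfolding continuous_on_iff by (metis atLeastAtMost_iff order_refl zero_le_one)
      with e that show thesis by (metis dist_commute mem_ball subsetD)
    qed
    define t1 where "t1 = max ((t0 + 1)/2) (1 - d/2)"
    have "(t0 + 1)/2 \<le> t1" "1 - d/2 \<le> t1" "t1 < 1" using d t0 by (auto simp: t1_def)
    then show thesis using d t0 by (intro that[of t1]) (auto simp: dist_real_def)
  qed
  define w where "w = (t1 + 1) / 2"
  have w: "t1 < w" "w < 1" using t1 by (auto simp: w_def)
  \<comment> \<open>Within \<open>N0\<close> the only points of \<open>K\<close> are interior points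
    of the final piece of \<open>g\<close>.\<close>
  define N0 where "N0 = - (R \<union> g ` {0..t1} \<union> {g 1}) \<inter> U'"
  have "open N0" using R clg[of 0 t1] U t1 unfolding N0_def by (intro open_Int open_Compl closed_Un) auto
  moreover have "g w \<in> N0"
  proof -
    have "g w \<notin> R" using ends ne[of w 0] ne[of w 1] w t1 t0 by (auto simp: path_image_def)
    moreover have "g w \<notin> g ` {0..t1}" using ne[of w] w t1 t0 by force
    moreover have "g w \<noteq> g 1" using ne[of w 1] w t1 t0 by force
    ultimately show ?thesis using t1(3) w by (auto simp: N0_def)
  qed
  ultimately obtain r where r: "r > 0" "ball (g w) r \<subseteq> N0" by (meson open_contains_ball)
  have "g w \<in> closure C" using hC w t1 by (auto simp: imh)
  then obtain s' where s': "s' \<in> C" "s' \<in> ball (g w) r"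
    using r by (metis closure_approachable dist_commute mem_ball)
  define D where "D = connected_component_set (U' - K) s'"
  have s'D: "s' \<in> D" using s' r Csub by (auto simp: D_def N0_def)
  \<comment> \<open>Without such a contact nothing would bound \<open>D\<close> inside the ball, so
    \<open>D\<close> would contain its centre \<open>g w\<close>, a point of
    \<open>K\<close>.\<close>
  have "\<exists>u\<in>{t1<..<1}. g u \<in> closure D"
  proof (rule ccontr)
    assume no: "\<not> ?thesis"
    have "ball (g w) r \<subseteq> D"
    proof (rule connected_subset_if_closure)
      show "open D" using U clK by (simp add: D_def open_connected_component open_Diff)
      show "closure D \<inter> ball (g w) r \<subseteq> D"
      proof
        fix z assume z: "z \<in> closure D \<inter> ball (g w) r"
        have "z \<notin> K"
        proof
          assume "z \<in> K"
          then obtain u where u: "z = g u" "0 \<le> u" "u \<le> 1" using z r by (auto simp: K N0_def path_image_def)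
          then have "t1 < u \<and> u < 1" using z r by (force simp: N0_def)
          then show False using no z u by auto
        qed
        then show "z \<in> D"
          using z r closure_component_subset[of "U' - K" s'] by (auto simp: D_def N0_def)
      qed
    qed (use s'D s' in auto)
    then have "g w \<in> D" using r by auto
    moreover have "g w \<in> K" using w t1 t0 by (auto simp: K path_image_def)
    ultimately show False using connected_component_subset[of "U' - K" s'] by (auto simp: D_def)
  qed
  then have "\<exists>t0\<in>{0<..<1}. g ` {t0..1} \<subseteq> U' \<and> (\<exists>u\<in>{t0<..<1}. g u \<in> closure D)"
    using t1 t0 by (meson greaterThanLessThan_iff less_trans)
  moreover have "s' \<in> U' - K" using s' r Csub by (auto simp: N0_def)
  ultimately have "abutting K g U' s'"
    unfolding abutting_def D_def[symmetric] by blast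
  with s' that show thesis by (auto simp: C_def)
qed

text \<open>Shrinking along discs around \<open>g 1\<close> yields points whose successive members
  are joined inside ever smaller discs and off \<open>K\<close>; the infinite join of these paths
  converges to \<open>g 1\<close>.\<close>

lemma arc_end_accessible:
  fixes g :: "real \<Rightarrow> complex"
  assumes R: "closed R" and g: "arc g" and ends: "R \<inter> path_image g \<subseteq> {g 0, g 1}"
    and K: "K = R \<union> path_image g"
    and s: "s \<notin> K" and t: "0 < t" "t < 1" "g t \<in> closure (connected_component_set (- K) s)"
  obtains q where "path q" "connected_component (- K) s (pathstart q)" "pathfinish q = g 1"
    "path_image q \<subseteq> insert (g 1) (- K)"
proof -
  define U where "U n = ball (g 1) (1 / real (Suc n))" for n
  have "abutting K g UNIV s"
    using s t unfolding abutting_def Compl_eq_Diff_UNIV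
    by (intro conjI bexI[of _ "t/2"] bexI[of _ t]) auto
  then obtain s0 where s0: "abutting K g (U 0) s0" "s0 \<in> connected_component_set (- K) s"
    using abutting_shrink[OF R g ends K, of UNIV "U 0" s] by (auto simp: U_def Compl_eq_Diff_UNIV)
  \<comment> \<open>The clause for \<open>n = 0\<close> pins the first point to \<open>s0\<close>,
    which ties the chain to the face of \<open>s\<close>.\<close>
  have "\<exists>f. \<forall>n. (abutting K g (U n) (f n) \<and> (n = 0 \<longrightarrow> f n = s0)) \<and>
      f (Suc n) \<in> connected_component_set (U n - K) (f n)"
  proof (rule dependent_nat_choice)
    fix x n assume x: "abutting K g (U n) x \<and> (n = 0 \<longrightarrow> x = s0)"
    have "U (Suc n) \<subseteq> U n" unfolding U_def by (rule subset_ball) (simp add: field_simps)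
    then obtain y where "abutting K g (U (Suc n)) y" "y \<in> connected_component_set (U n - K) x"
      using x abutting_shrink[OF R g ends K, of "U n" "U (Suc n)" x] by (auto simp: U_def)
    then show "\<exists>y. (abutting K g (U (Suc n)) y \<and> (Suc n = 0 \<longrightarrow> y = s0)) \<and>
        y \<in> connected_component_set (U n - K) x" by auto
  qed (use s0 in auto)
  then obtain f where f: "\<And>n. f (Suc n) \<in> connected_component_set (U n - K) (f n)" "f 0 = s0" by blast
  have clK: "closed K" using K R g by (simp add: closed_Un closed_arc_image)
  have "\<exists>p. path p \<and> path_image p \<subseteq> U n - K \<and> pathstart p = f n \<and> pathfinish p = f (Suc n)" for n
  proof -
    have "open (U n - K)" using clK by (auto simp: U_def)
    then have "path_component (U n - K) (f n) (f (Suc n))"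
      using f(1)[of n] by (simp add: open_path_connected_component)
    then show ?thesis by (simp add: path_component_def)
  qed
  then obtain p where p: "\<And>n. path (p n)" "\<And>n. path_image (p n) \<subseteq> U n - K"
    "\<And>n. pathstart (p n) = f n" "\<And>n. pathfinish (p n) = f (Suc n)" by metis
  show thesis
  proof (rule infinite_path_join[of p "- K" "g 1"])
    fix e :: real assume "e > 0"
    then obtain N where N: "1 / real (Suc N) < e" using nat_approx_posE by blast
    have "U n \<subseteq> ball (g 1) e" if "n \<ge> N" for n
    proof -
      have "1 / real (Suc n) \<le> 1 / real (Suc N)" using that by (simp add: frac_le)
      then show ?thesis using N unfolding U_def by (intro subset_ball) linarith
    qed
    then show "\<exists>N. \<forall>n\<ge>N. path_image (p n) \<subseteq> ball (g 1) e" using p(2) by blast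
  qed (use p f(2) s0 that in auto)
qed

text \<open>Both access paths start in the same open face, where they can be linked; a path between
  distinct points contains an arc.\<close>

lemma arc_between_accessible:
  fixes K :: "complex set"
  assumes K: "closed K" and q: "path q" "connected_component (- K) s (pathstart q)"
      "path_image q \<subseteq> insert a (- K)" "pathfinish q = a"
    and r: "path r" "connected_component (- K) s (pathstart r)"
      "path_image r \<subseteq> insert b (- K)" "pathfinish r = b" and "a \<noteq> b"
  obtains h where "arc h" "pathstart h = a" "pathfinish h = b" "path_image h \<subseteq> {a, b} \<union> - K"
proof -
  have "connected_component (- K) (pathstart q) (pathstart r)"
    using q(2) r(2) by (metis connected_component_sym connected_component_trans)
  then have "path_component (- K) (pathstart q) (pathstart r)"
    using K by (simp add: open_path_connected_component open_Compl)
  then obtain m where m: "path m" "path_image m \<subseteq> - K" "pathstart m = pathstart q" "pathfinish m = pathstart r"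
    by (auto simp: path_component_def)
  define j where "j = reversepath q +++ (m +++ r)"
  have "path j" "pathstart j = a" "pathfinish j = b" using q r m by (auto simp: j_def)
  moreover have "path_image j \<subseteq> {a, b} \<union> - K"
    using q r m by (auto simp: j_def path_image_join)
  ultimately show thesis using path_contains_arc[of j a b] \<open>a \<noteq> b\<close> that by (metis order_trans)
qed

section \<open>Redrawing the sides of a crossing\<close>

text \<open>The half \<open>g\<close> starts at \<open>x\<close>, so that the vertex to be accessed
  sits at parameter 1; the half \<open>h\<close> becomes part of the obstacle.\<close>

lemma split_arc_at_interior_point:
  fixes \<gamma> :: "real \<Rightarrow> complex"
  assumes "arc \<gamma>" "x \<in> arc_interior \<gamma>"
  obtains g h where "arc g" "arc h" "g 0 = x" "g 1 = \<gamma> 1" "\<gamma> 0 \<in> path_image h"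
    "path_image \<gamma> = path_image g \<union> path_image h" "path_image g \<inter> path_image h = {x}"
proof -
  have inj: "inj_on \<gamma> {0..1}" using assms by (simp add: arc_def)
  obtain \<tau> where \<tau>: "x = \<gamma> \<tau>" "0 < \<tau>" "\<tau> < 1"
    using assms by (force simp: arc_interior_def path_image_def pathstart_def pathfinish_def less_le)
  have img: "path_image (subpath \<tau> 1 \<gamma>) = \<gamma> ` {\<tau>..1}" "path_image (subpath 0 \<tau> \<gamma>) = \<gamma> ` {0..\<tau>}"
    using \<tau> by (simp_all add: path_image_subpath)
  have *: "{0..1} = {\<tau>..1} \<union> {0..\<tau>}" "{\<tau>..1} \<inter> {0..\<tau>} = {\<tau>}" using \<tau> by auto
  have "path_image \<gamma> = \<gamma> ` {\<tau>..1} \<union> \<gamma> ` {0..\<tau>}"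
    unfolding path_image_def by (metis *(1) image_Un)
  moreover have "\<gamma> ` {\<tau>..1} \<inter> \<gamma> ` {0..\<tau>} = {x}"
    using inj_on_image_Int[OF inj, of "{\<tau>..1}" "{0..\<tau>}"] * \<tau> by auto
  ultimately show thesis
    using assms \<tau> img
    by (intro that[of "subpath \<tau> 1 \<gamma>" "subpath 0 \<tau> \<gamma>"])
      (simp_all add: arc_subpath_arc, simp_all add: subpath_def)
qed

text \<open>In the chart the two edges are the axes, and a small disc misses \<open>L\<close>. One
  point of each half-edge in this disc suffices: they lie on two perpendicular half-axes, and the
  open quadrant between these is connected, avoids \<open>K\<close> and has both points in its
  closure.\<close>

lemma crossing_sector:
  assumes cr: "crosses_at G H x" and L: "closed L" "x \<notin> L"
    and g: "arc g" "g 0 = x" "path_image g \<subseteq> path_image G"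
    and k: "arc k" "k 0 = x" "path_image k \<subseteq> path_image H"
    and K: "K = path_image G \<union> path_image H \<union> L"
  obtains s t t' where "s \<notin> K" "0 < t" "t < 1" "0 < t'" "t' < 1"
    "g t \<in> closure (connected_component_set (- K) s)"
    "k t' \<in> closure (connected_component_set (- K) s)"
proof -
  obtain U \<phi> \<psi> where U: "open U" "x \<in> U" and hom: "homeomorphism U (ball 0 1) \<phi> \<psi>" and "\<phi> x = 0"
    and axG: "\<phi> ` (U \<inter> path_image G) = {z \<in> ball 0 1. Im z = 0}"
    and axH: "\<phi> ` (U \<inter> path_image H) = {z \<in> ball 0 1. Re z = 0}"
    using cr unfolding crosses_at_def by blast
  have \<psi>\<phi>: "\<psi> (\<phi> w) = w" "\<phi> w \<in> ball 0 1" if "w \<in> U" for w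
    using hom that by (auto simp: homeomorphism_def)
  have \<phi>\<psi>: "\<phi> (\<psi> z) = z" "\<psi> z \<in> U" if "z \<in> ball 0 1" for z
    using hom that by (auto simp: homeomorphism_def)
  have cont\<psi>: "continuous_on (ball 0 1) \<psi>" using hom by (simp add: homeomorphism_def)
  have "openin (top_of_set U) (U - L)" using U L by (simp add: openin_open_eq open_Diff)
  then have "openin (top_of_set (ball 0 1)) (\<phi> ` (U - L))" by (rule homeomorphism_imp_open_map[OF hom])
  then have "open (\<phi> ` (U - L))" by (simp add: openin_open_eq)
  moreover have "0 \<in> \<phi> ` (U - L)" using U L \<open>\<phi> x = 0\<close> by force
  ultimately obtain \<rho> where \<rho>: "\<rho> > 0" "ball 0 \<rho> \<subseteq> \<phi> ` (U - L)" by (meson open_contains_ball)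
  have \<rho>1: "ball (0::complex) \<rho> \<subseteq> ball 0 1" using \<rho>(2) homeomorphism_image1[OF hom] by blast
  have notL: "\<psi> z \<notin> L" if "z \<in> ball 0 \<rho>" for z
  proof -
    have "z \<in> \<phi> ` (U - L)" using \<rho>(2) that by blast
    then obtain y where "y \<in> U" "y \<notin> L" "z = \<phi> y" by blast
    then show ?thesis using \<psi>\<phi>(1) by simp
  qed
  define W where "W = \<psi> ` ball 0 \<rho>"
  have "openin (top_of_set (ball (0::complex) 1)) (ball 0 \<rho>)" using \<rho>1 by (simp add: openin_open_eq)
  then have "openin (top_of_set U) W"
    unfolding W_def by (rule homeomorphism_imp_open_map[OF homeomorphism_symD[OF hom]])
  then have W: "open W" using U by (simp add: openin_open_eq)
  have "x \<in> W" using \<rho> \<psi>\<phi>(1)[OF U(2)] \<open>\<phi> x = 0\<close> by (force simp: W_def)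
  have near: "\<exists>t. 0 < t \<and> t < 1 \<and> q t \<in> W \<and> q t \<noteq> x" if q: "arc q" "q 0 = x" for q
  proof -
    have "continuous_on {0..1} q" using q by (simp add: arc_def path_def)
    moreover obtain e where e: "e > 0" "ball x e \<subseteq> W" using W \<open>x \<in> W\<close> open_contains_ball by blast
    ultimately obtain d where d: "d > 0" "\<And>u. \<lbrakk>u \<in> {0..1}; dist u 0 < d\<rbrakk> \<Longrightarrow> dist (q u) (q 0) < e"
      unfolding continuous_on_iff by (metis atLeastAtMost_iff order_refl zero_le_one)
    obtain t where t: "0 < t" "t < d" "t < 1" using d field_lbound_gt_zero[of d 1] by auto
    then have "q t \<in> W" using d(2)[of t] e q by (auto simp: dist_commute)
    moreover have "q t \<noteq> q 0" using q t by (auto simp: arc_def dest: inj_onD[of q "{0..1}" t 0])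
    ultimately show ?thesis using t q by auto
  qed
  obtain t where t: "0 < t" "t < 1" "g t \<in> W" "g t \<noteq> x" using near[OF g(1,2)] by blast
  obtain t' where t': "0 < t'" "t' < 1" "k t' \<in> W" "k t' \<noteq> x" using near[OF k(1,2)] by blast
  obtain z where z: "z \<in> ball 0 \<rho>" "g t = \<psi> z" using t by (auto simp: W_def)
  obtain z' where z': "z' \<in> ball 0 \<rho>" "k t' = \<psi> z'" using t' by (auto simp: W_def)
  have "z \<in> \<phi> ` (U \<inter> path_image G)"
  proof -
    have "g t \<in> path_image G" using g(3) t by (auto simp: path_image_def)
    then show ?thesis using z \<rho>1 \<phi>\<psi>[of z] by (metis IntI image_eqI subsetD)
  qed
  then have imz: "Im z = 0" using axG by auto
  have "z' \<in> \<phi> ` (U \<inter> path_image H)"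
  proof -
    have "k t' \<in> path_image H" using k(3) t' by (auto simp: path_image_def)
    then show ?thesis using z' \<rho>1 \<phi>\<psi>[of z'] by (metis IntI image_eqI subsetD)
  qed
  then have rez: "Re z' = 0" using axH by auto
  \<comment> \<open>The signs select the quadrant adjacent to both chosen points, which treats all
    four sectors at once.\<close>
  define \<sigma> \<tau> where "\<sigma> = (if Re z \<ge> 0 then 1 else - 1 :: real)" and "\<tau> = (if Im z' \<ge> 0 then 1 else - 1 :: real)"
  define Q where "Q = {z \<in> ball 0 \<rho>. \<sigma> * Re z > 0 \<and> \<tau> * Im z > 0}"
  have \<sigma>\<tau>: "\<bar>\<sigma>\<bar> = 1" "\<bar>\<tau>\<bar> = 1" "\<sigma> * \<sigma> = 1" "\<tau> * \<tau> = 1" by (auto simp: \<sigma>_def \<tau>_def)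
  have closQ: "w \<in> closure Q" if w: "w \<in> ball 0 \<rho>" "\<sigma> * Re w \<ge> 0" "\<tau> * Im w \<ge> 0" for w
    unfolding closure_approachable
  proof (intro allI impI)
    fix e :: real assume "e > 0"
    then obtain d where d: "0 < d" "d < e / 2" "d < (\<rho> - cmod w) / 2"
      using field_lbound_gt_zero[of "e/2" "(\<rho> - cmod w) / 2"] w by auto
    define y where "y = w + Complex (d * \<sigma>) (d * \<tau>)"
    have "cmod (Complex (d * \<sigma>) (d * \<tau>)) \<le> 2 * d"
      using cmod_le[of "Complex (d * \<sigma>) (d * \<tau>)"] \<sigma>\<tau> d by (simp add: abs_mult)
    then have "dist y w < e" "cmod y < \<rho>"
      using d norm_triangle_ineq[of w "Complex (d * \<sigma>) (d * \<tau>)"] by (auto simp: y_def dist_norm)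
    moreover have "\<sigma> * Re y > 0" "\<tau> * Im y > 0"
    proof -
      have "\<sigma> * Re y = \<sigma> * Re w + d * (\<sigma> * \<sigma>)" "\<tau> * Im y = \<tau> * Im w + d * (\<tau> * \<tau>)"
        by (simp_all add: y_def algebra_simps)
      then show "\<sigma> * Re y > 0" "\<tau> * Im y > 0" using w d \<sigma>\<tau> by auto
    qed
    ultimately show "\<exists>y\<in>Q. dist y w < e" by (auto simp: Q_def)
  qed
  have clos\<psi>: "\<psi> w \<in> closure (\<psi> ` Q)" if w: "w \<in> ball 0 \<rho>" "\<sigma> * Re w \<ge> 0" "\<tau> * Im w \<ge> 0" for w
    unfolding closure_approachable
  proof (intro allI impI)
    fix e :: real assume "e > 0"
    then obtain d where d: "d > 0" "\<And>y. \<lbrakk>y \<in> ball 0 1; dist y w < d\<rbrakk> \<Longrightarrow> dist (\<psi> y) (\<psi> w) < e"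
      using cont\<psi> w \<rho>1 unfolding continuous_on_iff by (metis subsetD)
    obtain y where y: "y \<in> Q" "dist y w < d" using closQ[OF w] d by (auto simp: closure_approachable)
    then have "y \<in> ball 0 1" using \<rho>1 by (auto simp: Q_def)
    then show "\<exists>y\<in>\<psi> ` Q. dist y (\<psi> w) < e" using d y by blast
  qed
  have z0: "\<sigma> * Re z \<ge> 0" "\<tau> * Im z \<ge> 0" "\<sigma> * Re z' \<ge> 0" "\<tau> * Im z' \<ge> 0"
    using imz rez by (auto simp: \<sigma>_def \<tau>_def)
  \<comment> \<open>Written as an intersection of a disc and two half-planes, the quadrant is
    visibly convex.\<close>
  have "Q = ball 0 \<rho> \<inter> {z. inner (of_real \<sigma>) z > 0} \<inter> {z. inner (Complex 0 \<tau>) z > 0}"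
    by (auto simp: Q_def inner_complex_def)
  then have "convex Q" by (auto intro!: convex_Int convex_halfspace_gt)
  then have "connected (\<psi> ` Q)"
    using cont\<psi> \<rho>1 by (intro connected_continuous_image convex_connected continuous_on_subset[OF cont\<psi>]) (auto simp: Q_def)
  moreover have "\<psi> ` Q \<subseteq> - K"
  proof
    fix v assume "v \<in> \<psi> ` Q"
    then obtain y where y: "v = \<psi> y" "y \<in> Q" by auto
    then have yb: "y \<in> ball 0 \<rho>" "y \<in> ball 0 1" "Re y \<noteq> 0" "Im y \<noteq> 0" using \<rho>1 by (auto simp: Q_def)
    have "v \<notin> path_image G"
    proof
      assume "v \<in> path_image G"
      then have "y \<in> \<phi> ` (U \<inter> path_image G)" using \<phi>\<psi>[OF yb(2)] y by (metis IntI image_eqI)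
      then show False using axG yb by auto
    qed
    moreover have "v \<notin> path_image H"
    proof
      assume "v \<in> path_image H"
      then have "y \<in> \<phi> ` (U \<inter> path_image H)" using \<phi>\<psi>[OF yb(2)] y by (metis IntI image_eqI)
      then show False using axH yb by auto
    qed
    ultimately show "v \<in> - K" using notL[OF yb(1)] y K by auto
  qed
  moreover obtain s where s: "s \<in> \<psi> ` Q"
    using closQ[OF z(1) z0(1,2)] by (metis closure_empty empty_iff ex_in_conv image_is_empty)
  ultimately have sub: "\<psi> ` Q \<subseteq> connected_component_set (- K) s" and "s \<notin> K"
    using connected_component_maximal[of s "\<psi> ` Q" "- K"] by blast+
  then show thesis
    using that[of s t t'] t t' clos\<psi>[OF z(1) z0(1,2)] clos\<psi>[OF z'(1) z0(3,4)] z z' closure_mono[OF sub]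
    by auto
qed

lemma arc_interior_reversepath [simp]: "arc_interior (reversepath g) = arc_interior g"
  by (auto simp: arc_interior_def)

text \<open>The sector at the crossing gives a face of the complete drawing \<open>K\<close> that
  touches both half-edges, hence both of their ends are accessible from it. As the arc stays in this
  face, it meets no edge in its interior, including the old curve of \<open>{a, b}\<close> if that
  is an edge.\<close>

lemma kite_side_arc:
  assumes G: "simple_graph V E" and D: "one_planar_drawing V E p c"
    and ef: "e \<in> E" "f \<in> E" "edges_cross c e f" and ab: "a \<in> e" "b \<in> f"
    and K: "K = p ` V \<union> (\<Union>e\<in>E. path_image (c e))"
  obtains h where "arc h" "pathstart h = p a" "pathfinish h = p b" "path_image h \<subseteq> {p a, p b} \<union> - K"
proof -
  have fin: "finite V" "finite E" and sub: "\<And>e. e \<in> E \<Longrightarrow> e \<subseteq> V" 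
    using G by (auto simp: simple_graph_def intro: finite_subset[of E "Pow V"])
  have D1: "drawing V E p c"
    and D2: "\<And>e f. \<lbrakk>e \<in> E; f \<in> E; edges_cross c e f\<rbrakk> \<Longrightarrow>
        (\<exists>!x. x \<in> arc_interior (c e) \<inter> arc_interior (c f)) \<and> e \<inter> f = {} \<and>
        (\<forall>g\<in>E. edges_cross c e g \<longrightarrow> g = f)"
    using D by (auto simp: one_planar_drawing_def)
  have arcs: "\<And>e. e \<in> E \<Longrightarrow> arc (c e)"
    and ends: "\<And>e. e \<in> E \<Longrightarrow> {pathstart (c e), pathfinish (c e)} = p ` e"
    and avoid: "\<And>e. e \<in> E \<Longrightarrow> arc_interior (c e) \<inter> p ` V = {}"
    and crs: "\<And>e f x. \<lbrakk>e \<in> E; f \<in> E; e \<noteq> f; x \<in> arc_interior (c e) \<inter> arc_interior (c f)\<rbrakk> \<Longrightarrow> crosses_at (c e) (c f) x"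
    and inj: "inj_on p V"
    using D1 unfolding drawing_def by blast+
  have fe: "edges_cross c f e" using ef(3) by (auto simp: edges_cross_def)
  obtain x where x: "x \<in> arc_interior (c e) \<inter> arc_interior (c f)" using ef by (auto simp: edges_cross_def)
  have outside: "path_image (c e') \<subseteq> p ` V \<union> arc_interior (c e')" if "e' \<in> E" for e'
    using ends[OF that] sub[OF that] by (fastforce simp: arc_interior_def)
  \<comment> \<open>A half-edge meets the rest \<open>R\<close> of the drawing only at its two ends:
    any other common point would be a further crossing of \<open>e1\<close>, which 1-planarity rules
    out.\<close>
  have arm: "\<exists>g R. arc g \<and> g 0 = x \<and> g 1 = p v \<and> path_image g \<subseteq> path_image (c e1) \<and> closed R \<and>
      R \<inter> path_image g \<subseteq> {g 0, g 1} \<and> K = R \<union> path_image g"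
    if e1: "e1 \<in> E" "f1 \<in> E" "edges_cross c e1 f1" "x \<in> arc_interior (c e1) \<inter> arc_interior (c f1)" "v \<in> e1"
    for e1 f1 v
  proof -
    obtain \<gamma> where \<gamma>: "arc \<gamma>" "\<gamma> 1 = p v" "path_image \<gamma> = path_image (c e1)" 
      "arc_interior \<gamma> = arc_interior (c e1)"
    proof (cases "pathfinish (c e1) = p v")
      case True
      then show thesis using arcs e1 that[of "c e1"] by (auto simp: pathfinish_def)
    next
      case False
      moreover have "p v \<in> {pathstart (c e1), pathfinish (c e1)}" unfolding ends[OF e1(1)] using e1(5) by simp
      ultimately have "pathstart (c e1) = p v" by simp
      then show thesis using arcs e1 that[of "reversepath (c e1)"]
        by (simp add: arc_reversepath) (simp add: reversepath_def pathstart_def)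
    qed
    obtain g h where g: "arc g" "arc h" "g 0 = x" "g 1 = \<gamma> 1" "\<gamma> 0 \<in> path_image h"
      "path_image \<gamma> = path_image g \<union> path_image h" "path_image g \<inter> path_image h = {x}"
      using split_arc_at_interior_point[of \<gamma> x] \<gamma> e1 by auto
    define R where "R = p ` V \<union> (\<Union>e\<in>E - {e1}. path_image (c e)) \<union> path_image h"
    have "closed (\<Union>e\<in>E - {e1}. path_image (c e))"
      using fin arcs by (intro closed_UN) (auto simp: closed_arc_image)
    then have "closed R"
      unfolding R_def using fin g by (intro closed_Un) (auto simp: closed_arc_image finite_imp_closed)
    moreover have "R \<inter> path_image g \<subseteq> {g 0, g 1}"
    proof
      fix z assume z: "z \<in> R \<inter> path_image g"
      show "z \<in> {g 0, g 1}"
      proof (rule ccontr)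
        assume n: "z \<notin> {g 0, g 1}"
        then have "z \<notin> path_image h" using z g by auto
        then have "z \<noteq> \<gamma> 0" using g by auto
        then have zi: "z \<in> arc_interior (c e1)"
          using n z g unfolding \<gamma>(4)[symmetric] by (auto simp: arc_interior_def pathstart_def pathfinish_def)
        then have "z \<notin> p ` V" using avoid[OF e1(1)] by auto
        then obtain e' where e': "e' \<in> E" "e' \<noteq> e1" "z \<in> path_image (c e')"
          using z \<open>z \<notin> path_image h\<close> by (auto simp: R_def)
        then have zi': "z \<in> arc_interior (c e')" using outside \<open>z \<notin> p ` V\<close> by blast
        then have "edges_cross c e1 e'" using zi e' by (auto simp: edges_cross_def)
        then have "e' = f1" using D2[OF e1(1-3)] e' by auto
        then have "z = x" using D2[OF e1(1-3)] zi zi' e1(4) by blast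
        then show False using n g by simp
      qed
    qed
    moreover have "K = R \<union> path_image g"
      using g(6) \<gamma>(3) e1(1) unfolding K R_def by blast
    ultimately show ?thesis using g \<gamma> by (intro exI[of _ g] exI[of _ R]) auto
  qed
  obtain g R where g: "arc g" "g 0 = x" "g 1 = p a" "path_image g \<subseteq> path_image (c e)" "closed R"
      "R \<inter> path_image g \<subseteq> {g 0, g 1}" "K = R \<union> path_image g"
    using arm[of e f a] ef x ab by blast
  obtain k S where k: "arc k" "k 0 = x" "k 1 = p b" "path_image k \<subseteq> path_image (c f)" "closed S"
      "S \<inter> path_image k \<subseteq> {k 0, k 1}" "K = S \<union> path_image k"
    using arm[of f e b] ef fe x ab by blast
  define L where "L = p ` V \<union> (\<Union>e'\<in>E - {e, f}. path_image (c e'))"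
  have "closed (\<Union>e'\<in>E - {e, f}. path_image (c e'))"
    using fin arcs by (intro closed_UN) (auto simp: closed_arc_image)
  then have "closed L" unfolding L_def using fin by (intro closed_Un) (auto simp: finite_imp_closed)
  moreover have "x \<notin> L"
  proof
    assume "x \<in> L"
    then obtain e' where e': "e' \<in> E" "e' \<noteq> e" "e' \<noteq> f" "x \<in> path_image (c e')"
      using avoid[OF ef(1)] x by (auto simp: L_def)
    then have "x \<in> arc_interior (c e')" using outside avoid[OF ef(1)] x by blast
    then have "edges_cross c e e'" using x e' by (auto simp: edges_cross_def)
    then show False using D2[OF ef] e' by auto
  qed
  moreover have "K = path_image (c e) \<union> path_image (c f) \<union> L" using ef K by (auto simp: L_def)
  moreover have "crosses_at (c e) (c f) x" using crs ef x by (auto simp: edges_cross_def)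
  ultimately obtain s t t' where st: "s \<notin> K" "0 < t" "t < 1" "0 < t'" "t' < 1"
    "g t \<in> closure (connected_component_set (- K) s)"
    "k t' \<in> closure (connected_component_set (- K) s)"
    using crossing_sector[of "c e" "c f" x L g k K] g k by metis
  obtain q where q: "path q" "connected_component (- K) s (pathstart q)" "pathfinish q = p a"
    "path_image q \<subseteq> insert (p a) (- K)"
    using arc_end_accessible[OF g(5) g(1) g(6) g(7) st(1) st(2,3,6)] g(3) by metis
  obtain r where r: "path r" "connected_component (- K) s (pathstart r)" "pathfinish r = p b"
    "path_image r \<subseteq> insert (p b) (- K)"
    using arc_end_accessible[OF k(5) k(1) k(6) k(7) st(1) st(4,5,7)] k(3) by metis
  have "p a \<noteq> p b"
    using inj sub[OF ef(1)] sub[OF ef(2)] ab D2[OF ef] by (metis IntI empty_iff inj_onD subsetD)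
  moreover have "closed K" using g by (simp add: closed_Un closed_arc_image)
  ultimately show thesis
    using arc_between_accessible[OF _ q(1,2,4,3) r(1,2,4,3)] that by metis
qed

section \<open>Removing crossings by redrawing\<close>

lemma drawing_subset:
  assumes D: "drawing V E p c" and "F \<subseteq> E"
  shows "drawing V F p c"
proof -
  have "e \<in> E" if "e \<in> F" for e using assms that by blast
  then show ?thesis using D unfolding drawing_def by simp
qed

text \<open>Crossings can only disappear. The second claim records that \<open>e0\<close> loses all
  of its crossings, which drives the minimality argument.\<close>

lemma redraw_edge:
  assumes D: "one_planar_drawing V E p c" and e0: "e0 \<in> E"
    and h: "arc h" "{pathstart h, pathfinish h} = p ` e0"
      "arc_interior h \<inter> (p ` V \<union> (\<Union>e\<in>E. path_image (c e))) = {}"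
  shows "one_planar_drawing V E p (c(e0 := h))"
    and "\<And>e f. \<lbrakk>e \<in> E; f \<in> E; edges_cross (c(e0 := h)) e f\<rbrakk> \<Longrightarrow> e \<noteq> e0 \<and> f \<noteq> e0 \<and> edges_cross c e f"
proof -
  have no: "arc_interior h \<inter> arc_interior (c e) = {}" if "e \<in> E" for e
    using h(3) that by (auto simp: arc_interior_def)
  show *: "e \<noteq> e0 \<and> f \<noteq> e0 \<and> edges_cross c e f"
    if "e \<in> E" "f \<in> E" "edges_cross (c(e0 := h)) e f" for e f
    using that no by (auto simp: edges_cross_def split: if_splits)
  have dr: "drawing V E p c" using D by (simp add: one_planar_drawing_def)
  have "drawing V E p (c(e0 := h))"
    unfolding drawing_def
  proof (rule conjI[OF _ conjI]; (intro ballI impI)?)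
    show "inj_on p V" using dr by (simp add: drawing_def)
  next
    fix e assume "e \<in> E"
    then show "arc ((c(e0 := h)) e) \<and> {pathstart ((c(e0 := h)) e), pathfinish ((c(e0 := h)) e)} = p ` e \<and>
        arc_interior ((c(e0 := h)) e) \<inter> p ` V = {}"
      using dr h by (cases "e = e0") (auto simp: drawing_def)
  next
    fix e f x assume ef: "e \<in> E" "f \<in> E" "e \<noteq> f" "x \<in> arc_interior ((c(e0 := h)) e) \<inter> arc_interior ((c(e0 := h)) f)"
    then have "edges_cross (c(e0 := h)) e f" unfolding edges_cross_def by blast
    then have "e \<noteq> e0" "f \<noteq> e0" using * ef by blast+
    then show "crosses_at ((c(e0 := h)) e) ((c(e0 := h)) f) x" using ef dr by (simp add: drawing_def)
  qed
  moreover have "(\<exists>!x. x \<in> arc_interior ((c(e0 := h)) e) \<inter> arc_interior ((c(e0 := h)) f)) \<and> e \<inter> f = {} \<and>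
      (\<forall>g\<in>E. edges_cross (c(e0 := h)) e g \<longrightarrow> g = f)"
    if "e \<in> E" "f \<in> E" "edges_cross (c(e0 := h)) e f" for e f
  proof -
    have "e \<noteq> e0" "f \<noteq> e0" "edges_cross c e f" using *[OF that] by auto
    then show ?thesis using D that * unfolding one_planar_drawing_def by simp
  qed
  ultimately show "one_planar_drawing V E p (c(e0 := h))"
    unfolding one_planar_drawing_def by blast
qed

lemma locally_maximal_drawing_with_uncrossed_kites:
  assumes G: "simple_graph V E" and "locally_maximal_one_planar V E"
  obtains p c where "one_planar_drawing V E p c"
    "\<And>e f. \<lbrakk>e \<in> E; f \<in> E; edges_cross c e f\<rbrakk> \<Longrightarrow> full_crossing E e f"
    "\<And>e f a b g. \<lbrakk>e \<in> E; f \<in> E; edges_cross c e f; a \<in> e; b \<in> f; g \<in> E\<rbrakk> \<Longrightarrow> \<not> edges_cross c {a, b} g"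
proof -
  define X where "X c = {(e, f) \<in> E \<times> E. edges_cross c e f}" for c :: "'a set \<Rightarrow> real \<Rightarrow> complex"
  have finE: "finite E" using G by (auto simp: simple_graph_def intro: finite_subset[of E "Pow V"])
  then have finX: "finite (X c)" for c by (auto simp: X_def intro: finite_subset[of _ "E \<times> E"])
  \<comment> \<open>Minimisation runs only over drawings with full crossings. Fullness depends on
    \<open>E\<close> and the pair, not on the curves, so redrawing an edge preserves
    \<open>P\<close>.\<close>
  define P where "P c \<longleftrightarrow> (\<exists>p. one_planar_drawing V E p c) \<and> (\<forall>e\<in>E. \<forall>f\<in>E. edges_cross c e f \<longrightarrow> full_crossing E e f)" for c
  obtain c0 where "P c0" using assms(2) by (auto simp: locally_maximal_one_planar_def P_def)
  then obtain c where c: "P c" "\<And>c'. P c' \<Longrightarrow> card (X c) \<le> card (X c')"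
    using ex_has_least_nat[of P c0 "\<lambda>c. card (X c)"] by auto
  then obtain p where p: "one_planar_drawing V E p c" by (auto simp: P_def)
  have full: "\<And>e f. \<lbrakk>e \<in> E; f \<in> E; edges_cross c e f\<rbrakk> \<Longrightarrow> full_crossing E e f" using c by (auto simp: P_def)
  have "\<not> edges_cross c {a, b} g" if ef: "e \<in> E" "f \<in> E" "edges_cross c e f" "a \<in> e" "b \<in> f" and g: "g \<in> E" for e f a b g
  proof
    assume cr: "edges_cross c {a, b} g"
    have "a \<noteq> b" using p ef by (auto simp: one_planar_drawing_def)
    then have abE: "{a, b} \<in> E" using full[OF ef(1-3)] ef by (auto simp: full_crossing_def)
    obtain h where h: "arc h" "pathstart h = p a" "pathfinish h = p b"
      "path_image h \<subseteq> {p a, p b} \<union> - (p ` V \<union> (\<Union>e\<in>E. path_image (c e)))"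
      using kite_side_arc[OF G p ef refl] by blast
    have h': "{pathstart h, pathfinish h} = p ` {a, b}"
      "arc_interior h \<inter> (p ` V \<union> (\<Union>e\<in>E. path_image (c e))) = {}"
      using h by (auto simp: arc_interior_def)
    note r = redraw_edge[OF p abE h(1) h']
    have "P (c({a, b} := h))" using r full unfolding P_def by blast
    moreover have "X (c({a, b} := h)) \<subset> X c"
    proof
      show "X (c({a, b} := h)) \<subseteq> X c" using r(2) by (auto simp: X_def)
      have "({a, b}, g) \<in> X c" using abE g cr by (auto simp: X_def)
      moreover have "({a, b}, g) \<notin> X (c({a, b} := h))" using r(2)[of "{a, b}" g] by (auto simp: X_def)
      ultimately show "X (c({a, b} := h)) \<noteq> X c" by blast
    qed
    ultimately show False using c(2) psubset_card_mono[OF finX] by (meson leD)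
  qed
  then show thesis using that[OF p full] by blast
qed

section \<open>Deleting one edge of every crossing pair\<close>

definition reach :: "'a set set \<Rightarrow> ('a \<times> 'a) set" where
  "reach E = {(x, y). {x, y} \<in> E}\<^sup>*"

lemma reach_sym: "(u, v) \<in> reach E \<Longrightarrow> (v, u) \<in> reach E"
  unfolding reach_def by (rule symD[OF sym_rtrancl]) (auto simp: sym_def insert_commute)

lemma reach_refl [simp]: "(u, u) \<in> reach E"
  by (simp add: reach_def)

lemma reach_trans: "(u, v) \<in> reach E \<Longrightarrow> (v, w) \<in> reach E \<Longrightarrow> (u, w) \<in> reach E"
  by (simp add: reach_def)

lemma reach_edge: "{u, v} \<in> E \<Longrightarrow> (u, v) \<in> reach E"
  by (auto simp: reach_def)

lemma reach_edge_iff: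
  assumes "{u, v} \<in> E"
  shows "(w, u) \<in> reach E \<longleftrightarrow> (w, v) \<in> reach E"
  using reach_edge[OF assms] by (blast intro: reach_trans reach_sym)

lemma reach_closed:
  assumes "(u, v) \<in> reach E" "u \<in> Z" "\<And>x y. \<lbrakk>x \<in> Z; {x, y} \<in> E\<rbrakk> \<Longrightarrow> y \<in> Z"
  shows "v \<in> Z"
  using assms(1,2) unfolding reach_def by (induction rule: rtrancl_induct) (auto intro: assms(3))

text \<open>Rerouting principle: connectivity survives deletions once every single edge has a
  bypass.\<close>

lemma reach_replace_edges:
  assumes "(u, v) \<in> reach E" "\<And>x y. {x, y} \<in> E \<Longrightarrow> (x, y) \<in> reach F"
  shows "(u, v) \<in> reach F"
  using assms(1) unfolding reach_def
  by (induction rule: rtrancl_induct) (auto intro: rtrancl_trans assms(2)[unfolded reach_def])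

lemma connected_graph_reach:
  "connected_graph V E \<longleftrightarrow> V \<noteq> {} \<and> (\<forall>u\<in>V. \<forall>v\<in>V. (u, v) \<in> reach E)"
  by (simp add: connected_graph_def reach_def)

text \<open>\<open>A\<close> and its complement separate \<open>a\<close> from \<open>c\<close>,
  \<open>B\<close> and its complement separate \<open>b\<close> from \<open>d\<close>. A fifth
  vertex \<open>z\<close> lies on one side of each, which singles out one end of either edge; these
  two ends would form a 2-cut.\<close>

lemma not_both_crossing_edges_bridges:
  assumes con: "k_connected 3 V E" and card: "card V \<noteq> 4"
    and V: "a \<in> V" "b \<in> V" "c \<in> V" "d \<in> V" and dist: "distinct [a, b, c, d]"
    and ac: "(a, c) \<notin> reach ({h \<in> E. h \<inter> {b, d} = {}} - {{a, c}})"
    and bd: "(b, d) \<notin> reach ({h \<in> E. h \<inter> {a, c} = {}} - {{b, d}})"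
    and sub: "\<And>h. h \<in> E \<Longrightarrow> h \<subseteq> V"
  shows False
proof -
  have "card V > 4" "finite V"
    using con card by (auto simp: k_connected_def intro: card_ge_0_finite)
  moreover have "card {a, b, c, d} \<le> 4" using dist by simp
  ultimately have "\<not> V \<subseteq> {a, b, c, d}" using card_mono[of "{a, b, c, d}" V] by force
  then obtain z where z: "z \<in> V" "z \<notin> {a, b, c, d}" by blast
  define A where "A = {v. (a, v) \<in> reach ({h \<in> E. h \<inter> {b, d} = {}} - {{a, c}})}"
  define B where "B = {v. (b, v) \<in> reach ({h \<in> E. h \<inter> {a, c} = {}} - {{b, d}})}"
  have stepA: "x \<in> A \<longleftrightarrow> y \<in> A" if "{x, y} \<in> E" "{x, y} \<inter> {b, d} = {}" "{x, y} \<noteq> {a, c}" for x y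
  proof -
    have "{x, y} \<in> {h \<in> E. h \<inter> {b, d} = {}} - {{a, c}}" using that by blast
    then show ?thesis unfolding A_def mem_Collect_eq by (rule reach_edge_iff)
  qed
  have stepB: "x \<in> B \<longleftrightarrow> y \<in> B" if "{x, y} \<in> E" "{x, y} \<inter> {a, c} = {}" "{x, y} \<noteq> {b, d}" for x y
  proof -
    have "{x, y} \<in> {h \<in> E. h \<inter> {a, c} = {}} - {{b, d}}" using that by blast
    then show ?thesis unfolding B_def mem_Collect_eq by (rule reach_edge_iff)
  qed
  have abcd: "a \<in> A" "c \<notin> A" "b \<in> B" "d \<notin> B" using ac bd by (auto simp: A_def B_def)
  \<comment> \<open>\<open>u\<close> and \<open>w\<close> are the ends on the side of
    \<open>z\<close>; the opposite ends \<open>u'\<close> and \<open>w'\<close> are to be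
    unreachable from \<open>z\<close> once \<open>u\<close> and \<open>w\<close> are
    removed.\<close>
  have corner: False
    if "u \<in> {a, c}" "w \<in> {b, d}" "z \<in> A \<longleftrightarrow> u \<in> A" "z \<in> B \<longleftrightarrow> w \<in> B" for u w
  proof -
    obtain u' where u': "u' \<in> {a, c}" "u' \<noteq> u" "u' \<in> A \<longleftrightarrow> u \<notin> A" using that abcd by auto
    obtain w' where w': "w' \<in> {b, d}" "w' \<noteq> w" "w' \<in> B \<longleftrightarrow> w \<notin> B" using that abcd by auto
    have eqs: "{a, c} = {u, u'}" "{b, d} = {w, w'}" using u' w' that by auto
    have ds: "u \<noteq> w" "u \<noteq> w'" "u' \<noteq> w" "u' \<noteq> w'" using u' w' that dist by auto
    have zn: "z \<notin> {u, u', w, w'}" using z u' w' that by auto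
    have "card {u, w} < 3" using card_insert_le_m1[of 2 "{w}" u] by simp
    moreover have "{u, w} \<subseteq> V" "u' \<in> V" using that u' V by auto
    ultimately have "connected_graph (V - {u, w}) {e \<in> E. e \<inter> {u, w} = {}}"
      using con unfolding k_connected_def by blast
    moreover have "z \<in> V - {u, w}" "u' \<in> V - {u, w}" using z zn \<open>u' \<in> V\<close> u' ds by auto
    ultimately have r: "(z, u') \<in> reach {e \<in> E. e \<inter> {u, w} = {}}"
      unfolding connected_graph_reach by blast
    define Z where "Z = {v. v \<notin> {u, u', w, w'} \<and> (v \<in> A \<longleftrightarrow> u \<in> A) \<and> (v \<in> B \<longleftrightarrow> w \<in> B)}"
    have "u' \<in> Z"
    proof (rule reach_closed[OF r])
      show "z \<in> Z" using zn that by (auto simp: Z_def)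
      fix x y assume x: "x \<in> Z" and xy: "{x, y} \<in> {e \<in> E. e \<inter> {u, w} = {}}"
      then have E: "{x, y} \<in> E" "y \<noteq> u" "y \<noteq> w" by auto
      have xn: "x \<notin> {u, u', w, w'}" using x by (simp add: Z_def)
      \<comment> \<open>An edge off \<open>{b, d}\<close> preserves the \<open>A\<close>-side, so
        \<open>u'\<close> cannot be entered from \<open>Z\<close>; symmetrically, the
        \<open>B\<close>-side bars \<open>w'\<close>.\<close>
      have yA: "y \<in> A \<longleftrightarrow> u \<in> A" if "y \<noteq> w'"
        using stepA[OF E(1)] x xn E that unfolding Z_def eqs by (auto simp: doubleton_eq_iff)
      have yB: "y \<in> B \<longleftrightarrow> w \<in> B" if "y \<noteq> u'"
        using stepB[OF E(1)] x xn E that unfolding Z_def eqs by (auto simp: doubleton_eq_iff)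
      have "y \<noteq> u'" using yA u' ds by auto
      moreover have "y \<noteq> w'" using yB w' ds by auto
      ultimately show "y \<in> Z" using yA yB E by (simp add: Z_def)
    qed
    then show False by (simp add: Z_def)
  qed
  show False
    using corner[of a b] corner[of a d] corner[of c b] corner[of c d] abcd by blast
qed

text \<open>Only the combinatorics of crossings enters: they form a matching on the edges whose kite
  sides are uncrossed edges. A deleted edge that avoids the cut \<open>X\<close> is bypassed by two
  kite sides through an end of its partner outside \<open>X\<close>. If the partner equals
  \<open>X\<close>, the detour is taken instead; deleted edges on it have other partners, so the
  kite bypass works for them and no regress arises.\<close>

lemma crossing_selection_3_connected:
  fixes cr :: "'a set \<Rightarrow> 'a set \<Rightarrow> bool"
  assumes G: "simple_graph V E" and con: "k_connected 3 V E" and card: "card V \<noteq> 4"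
    and sym: "\<And>e f. cr e f \<Longrightarrow> cr f e"
    and disj: "\<And>e f. \<lbrakk>e \<in> E; f \<in> E; cr e f\<rbrakk> \<Longrightarrow> e \<inter> f = {}"
    and uniq: "\<And>e f g. \<lbrakk>e \<in> E; f \<in> E; g \<in> E; cr e f; cr e g\<rbrakk> \<Longrightarrow> g = f"
    and kite: "\<And>e f a b. \<lbrakk>e \<in> E; f \<in> E; cr e f; a \<in> e; b \<in> f\<rbrakk> \<Longrightarrow> {a, b} \<in> E"
    and uncr: "\<And>e f a b g. \<lbrakk>e \<in> E; f \<in> E; cr e f; a \<in> e; b \<in> f; g \<in> E\<rbrakk> \<Longrightarrow> \<not> cr {a, b} g"
  shows "\<exists>F\<subseteq>E. k_connected 3 V F \<and> (\<forall>e\<in>F. \<forall>f\<in>F. \<not> cr e f)"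
proof -
  have sub: "e \<subseteq> V" and c2: "card e = 2" if "e \<in> E" for e using G that by (auto simp: simple_graph_def)
  \<comment> \<open>The detour lives in all of \<open>E\<close>, not in the selected edges, so it is
    independent of the choices made for other pairs.\<close>
  define detour where "detour e f \<longleftrightarrow> (\<forall>x y. e = {x, y} \<longrightarrow> (x, y) \<in> reach ({h \<in> E. h \<inter> f = {}} - {e}))"
    for e f
  have ex: "detour e f \<or> detour f e" if ef: "e \<in> E" "f \<in> E" "cr e f" for e f
  proof (rule ccontr)
    assume "\<not> ?thesis"
    then obtain a c b d where "e = {a, c}" "(a, c) \<notin> reach ({h \<in> E. h \<inter> f = {}} - {e})"
      "f = {b, d}" "(b, d) \<notin> reach ({h \<in> E. h \<inter> e = {}} - {f})"
      unfolding detour_def by blast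
    moreover from this have "distinct [a, b, c, d]" "a \<in> V" "b \<in> V" "c \<in> V" "d \<in> V"
      using sub[OF ef(1)] sub[OF ef(2)] c2[OF ef(1)] c2[OF ef(2)] disj[OF ef] by (auto simp: card_insert_if split: if_splits)
    ultimately show False
      using not_both_crossing_edges_bridges[OF con card, of a b c d] sub by auto
  qed
  \<comment> \<open>\<open>r\<close> names the edge to delete. Its argument is the unordered pair,
    so both crossing edges refer to the same choice.\<close>
  define r where "r P = (SOME e. e \<in> P \<and> (\<forall>f\<in>P - {e}. detour e f))" for P :: "'a set set"
  have nn: "e \<noteq> f" if "e \<in> E" "f \<in> E" "cr e f" for e f
    using disj[OF that] c2[OF that(1)] by auto
  have r: "(r {e, f} = e \<and> detour e f) \<or> (r {e, f} = f \<and> detour f e)" if ef: "e \<in> E" "f \<in> E" "cr e f" for e f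
  proof -
    have "\<exists>g. g \<in> {e, f} \<and> (\<forall>h\<in>{e, f} - {g}. detour g h)" using ex[OF ef] by auto
    then have "r {e, f} \<in> {e, f} \<and> (\<forall>h\<in>{e, f} - {r {e, f}}. detour (r {e, f}) h)"
      unfolding r_def by (rule someI_ex)
    then show ?thesis using nn[OF ef] by auto
  qed
  define F where "F = {e \<in> E. \<forall>f\<in>E. cr e f \<longrightarrow> r {e, f} \<noteq> e}"
  have F_unless: "e \<in> F \<or> (\<exists>f\<in>E. cr e f \<and> detour e f)" if eE: "e \<in> E" for e
  proof (rule ccontr)
    assume no: "\<not> ?thesis"
    then obtain f where f: "f \<in> E" "cr e f" "r {e, f} = e" using eE by (auto simp: F_def)
    then have "detour e f" using r[OF eE f(1,2)] nn[OF eE f(1,2)] by auto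
    then show False using no f by blast
  qed
  have kF: "{a, b} \<in> F" if "e \<in> E" "f \<in> E" "cr e f" "a \<in> e" "b \<in> f" for e f a b
    using kite[OF that] uncr[OF that] by (auto simp: F_def)
  have "connected_graph (V - X) {e \<in> F. e \<inter> X = {}}" if X: "X \<subseteq> V" "card X < 3" for X
  proof -
    let ?FX = "{e \<in> F. e \<inter> X = {}}"
    have finX: "finite X" using X(1) G by (auto simp: simple_graph_def intro: finite_subset)
    have via: "(x, y) \<in> reach ?FX"
      if v: "{x, y} \<in> E" "{x, y} \<inter> X = {}" "f \<in> E" "cr {x, y} f" "\<not> f \<subseteq> X" for x y f
    proof -
      obtain b where b: "b \<in> f" "b \<notin> X" using v(5) by blast
      have "{x, b} \<in> ?FX" "{y, b} \<in> ?FX"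
        using kF[OF v(1,3,4) _ b(1)] v(2) b by auto
      then show ?thesis by (meson reach_edge reach_sym reach_trans)
    qed
    have base: "(x, y) \<in> reach ?FX" if xy: "{x, y} \<in> E" "{x, y} \<inter> X = {}" for x y
    proof (cases "{x, y} \<in> F")
      case True
      then show ?thesis using xy by (intro reach_edge) auto
    next
      case False
      then obtain f where f: "f \<in> E" "cr {x, y} f" "detour {x, y} f" using F_unless xy by blast
      show ?thesis
      proof (cases "f \<subseteq> X")
        case True
        \<comment> \<open>\<open>X\<close> has at most two elements and contains the two-element set
          \<open>f\<close>, so they coincide and the detour around \<open>f\<close> avoids exactly
          \<open>X\<close>.\<close>
        then have "card f = card X" using card_mono[OF finX True] c2[OF f(1)] X(2) by linarith
        then have fX: "f = X" by (rule card_subset_eq[OF finX True])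
        have "(x, y) \<in> reach ({h \<in> E. h \<inter> f = {}} - {{x, y}})" using f(3) by (auto simp: detour_def)
        then show ?thesis
        proof (rule reach_replace_edges)
          fix v w assume vw: "{v, w} \<in> {h \<in> E. h \<inter> f = {}} - {{x, y}}"
          show "(v, w) \<in> reach ?FX"
          proof (cases "{v, w} \<in> F")
            case True
            then show ?thesis using vw fX by (intro reach_edge) auto
          next
            case False
            then obtain f' where f': "f' \<in> E" "cr {v, w} f'" using F_unless vw by blast
            have vwE: "{v, w} \<in> E" "{v, w} \<inter> X = {}" "{v, w} \<noteq> {x, y}" using vw fX by blast+
            have "f' \<noteq> f"
            proof
              assume "f' = f"
              then have "{v, w} = {x, y}"
                using uniq[OF f(1) xy(1) vwE(1) sym[OF f(2)]] sym[OF f'(2)] by blast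
              then show False using vwE(3) by contradiction
            qed
            moreover have "card f' = card X" using fX c2[OF f(1)] c2[OF f'(1)] by simp
            ultimately have "\<not> f' \<subseteq> X" using fX card_subset_eq[OF finX, of f'] by blast
            then show ?thesis by (rule via[OF vwE(1,2) f'])
          qed
        qed
      qed (rule via[OF xy f(1,2)])
    qed
    have EX: "connected_graph (V - X) {e \<in> E. e \<inter> X = {}}" using con X unfolding k_connected_def by blast
    have "(u, v) \<in> reach ?FX" if "u \<in> V - X" "v \<in> V - X" for u v
    proof (rule reach_replace_edges)
      show "(u, v) \<in> reach {e \<in> E. e \<inter> X = {}}" using EX that unfolding connected_graph_reach by blast
    qed (use base in blast)
    then show ?thesis using EX unfolding connected_graph_reach by blast
  qed
  then have "k_connected 3 V F" using con by (simp add: k_connected_def)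
  moreover have "\<not> cr e f" if ef: "e \<in> F" "f \<in> F" for e f
  proof
    assume cr: "cr e f"
    have "e \<in> E" "f \<in> E" using ef by (auto simp: F_def)
    moreover have "r {e, f} \<noteq> e" using ef cr \<open>f \<in> E\<close> by (auto simp: F_def)
    moreover have "r {f, e} \<noteq> f" using ef sym[OF cr] \<open>e \<in> E\<close> by (auto simp: F_def)
    moreover have "{f, e} = {e, f}" by blast
    ultimately show False using r[OF _ _ cr] by simp
  qed
  moreover have "F \<subseteq> E" by (auto simp: F_def)
  ultimately show ?thesis by blast
qed

section \<open>A straight-line drawing of the complete graph on four vertices\<close>

text \<open>A triangle together with its centroid 0.\<close>

definition K4_point :: "nat \<Rightarrow> complex" where
  "K4_point n = (if n = 0 then 0 else if n = 1 then 1 else if n = 2 then \<i> else - 1 - \<i>)"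

text \<open>Each of the six segments is described by its line and an open range, which reduces
  disjointness to linear arithmetic.\<close>

lemma K4_segment_coordinates:
  assumes "i < j" "j < 4" and z: "z \<in> open_segment (K4_point i) (K4_point j)"
  shows "i = 0 \<and> j = 1 \<and> Im z = 0 \<and> 0 < Re z \<and> Re z < 1 \<or>
    i = 0 \<and> j = 2 \<and> Re z = 0 \<and> 0 < Im z \<and> Im z < 1 \<or>
    i = 0 \<and> j = 3 \<and> Re z = Im z \<and> - 1 < Re z \<and> Re z < 0 \<or>
    i = 1 \<and> j = 2 \<and> Re z + Im z = 1 \<and> 0 < Re z \<and> 0 < Im z \<or>
    i = 1 \<and> j = 3 \<and> Re z - 2 * Im z = 1 \<and> - 1 < Im z \<and> Im z < 0 \<or>
    i = 2 \<and> j = 3 \<and> Im z - 2 * Re z = 1 \<and> - 1 < Re z \<and> Re z < 0"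
proof -
  obtain t where t: "0 < t" "t < 1" "z = (1 - t) *\<^sub>R K4_point i + t *\<^sub>R K4_point j"
    using z by (auto simp: in_segment)
  have "i = 0 \<and> j = 1 \<or> i = 0 \<and> j = 2 \<or> i = 0 \<and> j = 3 \<or> i = 1 \<and> j = 2 \<or> i = 1 \<and> j = 3 \<or> i = 2 \<and> j = 3"
    using assms(1,2) by linarith
  then show ?thesis
    using t(1,2) unfolding t(3) by (elim disjE conjE) (simp_all add: K4_point_def algebra_simps)
qed

lemma K4_segments_disjoint:
  assumes ij: "i < j" "j < 4" and kl: "k < l" "l < 4" and ne: "(i, j) \<noteq> (k, l)"
  shows "open_segment (K4_point i) (K4_point j) \<inter> open_segment (K4_point k) (K4_point l) = {}"
proof (rule ccontr)
  assume "\<not> ?thesis"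
  then obtain z where "z \<in> open_segment (K4_point i) (K4_point j)" "z \<in> open_segment (K4_point k) (K4_point l)"
    by blast
  from K4_segment_coordinates[OF ij this(1)] K4_segment_coordinates[OF kl this(2)] ne
  show False by (elim disjE conjE) simp_all
qed

lemma K4_point_notin_segment:
  assumes ij: "i < j" "j < 4" and m: "m < 4"
  shows "K4_point m \<notin> open_segment (K4_point i) (K4_point j)"
proof
  assume "K4_point m \<in> open_segment (K4_point i) (K4_point j)"
  moreover have "m = 0 \<or> m = 1 \<or> m = 2 \<or> m = 3" using m by linarith
  ultimately show False
    using K4_segment_coordinates[OF ij] by (elim disjE) (force simp: K4_point_def)+
qed

lemma planar_if_card_4:
  assumes G: "simple_graph V E" and V: "card V = 4"
  shows "planar V E"
proof -
  have "finite V" using G by (simp add: simple_graph_def)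
  then obtain n where n: "bij_betw n V {0..<4::nat}" using V ex_bij_betw_finite_nat[of V] by auto
  then have injn: "inj_on n V" and n4: "\<And>v. v \<in> V \<Longrightarrow> n v < 4" by (auto simp: bij_betw_def)
  have "K4_point i \<noteq> K4_point j" if "i < j" "j < 4" for i j
  proof -
    have "(i, j) \<in> {(0,1),(0,2),(0,3),(1,2),(1,3),(2,3)}" using that by auto
    then show ?thesis by (auto simp: K4_point_def complex_eq_iff)
  qed
  then have K4_inj: "K4_point i \<noteq> K4_point j" if "i \<noteq> j" "i < 4" "j < 4" for i j
    using that by (metis nat_neq_iff)
  define p where "p v = K4_point (n v)" for v
  have "\<exists>u v. u \<in> V \<and> v \<in> V \<and> e = {u, v} \<and> n u < n v" if "e \<in> E" for e
  proof -
    have "card e = 2" "e \<subseteq> V" using that G by (auto simp: simple_graph_def)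
    then obtain u v where "e = {u, v}" "u \<noteq> v" "u \<in> V" "v \<in> V"
      unfolding card_2_iff by blast
    moreover from this have "n u \<noteq> n v" using injn by (auto dest: inj_onD)
    ultimately show ?thesis by (metis insert_commute nat_neq_iff)
  qed
  \<comment> \<open>Orienting each edge by the numbering leaves only the six index pairs with
    \<open>i < j\<close>.\<close>
  then obtain s t where st: "\<And>e. e \<in> E \<Longrightarrow> s e \<in> V \<and> t e \<in> V \<and> e = {s e, t e} \<and> n (s e) < n (t e)"
    by metis
  define c where "c e = linepath (p (s e)) (p (t e))" for e
  have int: "arc_interior (c e) = open_segment (p (s e)) (p (t e))" for e
    by (simp add: arc_interior_def c_def open_segment_def)
  have disj: "arc_interior (c e) \<inter> arc_interior (c f) = {}" if "e \<in> E" "f \<in> E" "e \<noteq> f" for e f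
    unfolding int p_def
  proof (rule K4_segments_disjoint)
    show "(n (s e), n (t e)) \<noteq> (n (s f), n (t f))"
      using that st[of e] st[of f] inj_onD[OF injn] by (metis prod.inject)
  qed (use st that n4 in auto)
  have avoid: "arc_interior (c e) \<inter> p ` V = {}" if "e \<in> E" for e
    using K4_point_notin_segment st[OF that] n4 unfolding int p_def by blast
  have "inj_on p V"
    using injn n4 K4_inj unfolding p_def inj_on_def by metis
  moreover have "arc (c e)" if "e \<in> E" for e
    using st[OF that] n4 K4_inj by (auto simp: c_def p_def)
  moreover have "{pathstart (c e), pathfinish (c e)} = p ` e" if "e \<in> E" for e
    using st[OF that] by (metis c_def image_empty image_insert pathfinish_linepath pathstart_linepath)
  ultimately have "drawing V E p c" using avoid disj by (auto simp: drawing_def)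
  then show ?thesis using disj unfolding planar_def edges_cross_def by blast
qed

theorem theorem5:
  fixes V :: "'a set" and E :: "'a set set"
  assumes "simple_graph V E"
    and "k_connected 3 V E"
    and "locally_maximal_one_planar V E"
  shows "\<exists>W F. spanning_subgraph W F V E \<and> k_connected 3 W F \<and> planar W F"
proof (cases "card V = 4")
  \<comment> \<open>Here the graph itself serves as the subgraph.\<close>
  case True
  then show ?thesis
    using assms planar_if_card_4 by (auto simp: spanning_subgraph_def)
next
  case False
  obtain p c where p: "one_planar_drawing V E p c"
    and full: "\<And>e f. \<lbrakk>e \<in> E; f \<in> E; edges_cross c e f\<rbrakk> \<Longrightarrow> full_crossing E e f"
    and uncr: "\<And>e f a b g. \<lbrakk>e \<in> E; f \<in> E; edges_cross c e f; a \<in> e; b \<in> f; g \<in> E\<rbrakk>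
      \<Longrightarrow> \<not> edges_cross c {a, b} g"
    using locally_maximal_drawing_with_uncrossed_kites[OF assms(1,3)] by metis
  have disj: "e \<inter> f = {}" if "e \<in> E" "f \<in> E" "edges_cross c e f" for e f
    using p that unfolding one_planar_drawing_def by blast
  have kite: "{a, b} \<in> E" if "e \<in> E" "f \<in> E" "edges_cross c e f" "a \<in> e" "b \<in> f" for e f a b
  proof -
    have "a \<noteq> b" using disj[OF that(1-3)] that by auto
    then show ?thesis using full[OF that(1-3)] that unfolding full_crossing_def by blast
  qed
  have uniq: "g = f" if "e \<in> E" "f \<in> E" "g \<in> E" "edges_cross c e f" "edges_cross c e g" for e f g
    using p that unfolding one_planar_drawing_def by blast
  have sym: "edges_cross c f e" if "edges_cross c e f" for e f
    using that by (auto simp: edges_cross_def)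
  have "\<exists>F\<subseteq>E. k_connected 3 V F \<and> (\<forall>e\<in>F. \<forall>f\<in>F. \<not> edges_cross c e f)"
    by (rule crossing_selection_3_connected[OF assms(1,2) False]) (fact sym disj uniq kite uncr)+
  then obtain F where F: "F \<subseteq> E" "k_connected 3 V F" "\<forall>e\<in>F. \<forall>f\<in>F. \<not> edges_cross c e f"
    by blast
  have "drawing V F p c"
    using drawing_subset[OF _ F(1)] p by (simp add: one_planar_drawing_def)
  then have "planar V F" using F(3) unfolding planar_def by blast
  then show ?thesis using F by (auto simp: spanning_subgraph_def)
qed

end
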